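(* Let $p$ and $q$ be distinct primes satisfying $p \equiv 33 \pmod{40}$ and $q \equiv 7 \pmod{40}$. Then the torsion subgroup $E_{pq}(\mathbb{Q})_{tors}$ of the elliptic curve $E_{pq}: y^2 = x^3 - 5pqx$ over $\mathbb{Q}$ is isomorphic to $\mathbb{Z}/2\mathbb{Z}$.
   Context: $E(\mathbb{Q})_{tors}$ denotes the subgroup of elements of finite order in the group $E(\mathbb{Q})$ of rational points. *)

theory Defs
  imports Complex_Main "HOL-Algebra.Elementary_Groups" "HOL-Computational_Algebra.Primes"
    "HOL-Number_Theory.Cong"
begin

(* A projective point of a short Weierstrass curve y^2 = x^3 + a x + b: either the
   point at infinity [0 : 1 : 0] or an affine point (x, y). *)
datatype 'a point = Infinity | Affine 'a 'a

fun on_curve :: "'a::field \<Rightarrow> 'a \<Rightarrow> 'a point \<Rightarrow> bool" where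
  "on_curve a b Infinity \<longleftrightarrow> True"
| "on_curve a b (Affine x y) \<longleftrightarrow> y^2 = x^3 + a * x + b"

(* Chord-and-tangent addition.  On the curve, the first branch is the case of a vertical
   line (Q = -P, including P = Q with y = 0).  If x1 = x2 otherwise, then P = Q with
   y1 \<noteq> 0 and the slope is that of the tangent. *)
fun point_add :: "'a::field \<Rightarrow> 'a point \<Rightarrow> 'a point \<Rightarrow> 'a point" where
  "point_add a Infinity Q = Q"
| "point_add a P Infinity = P"
| "point_add a (Affine x1 y1) (Affine x2 y2) =
    (if x1 = x2 \<and> y1 = - y2 then Infinity
     else let s = (if x1 = x2 then (3 * x1^2 + a) / (2 * y1) else (y2 - y1) / (x2 - x1));
              x3 = s^2 - x1 - x2
          in Affine x3 (s * (x1 - x3) - y1))"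

(* The group E(K) of K-rational points of E : y^2 = x^3 + a x + b, where K is the field
   given by the type 'a.  E is an elliptic curve only if 4 a^3 + 27 b^2 \<noteq> 0 and the
   characteristic of K is not 2; the definition itself does not impose this. *)
definition elliptic_curve_group :: "'a::field \<Rightarrow> 'a \<Rightarrow> 'a point monoid" where
  "elliptic_curve_group a b =
    \<lparr>carrier = {P. on_curve a b P}, monoid.mult = point_add a, one = Infinity\<rparr>"

definition torsion_subgroup :: "('a, 'm) monoid_scheme \<Rightarrow> ('a, 'm) monoid_scheme" where
  "torsion_subgroup G =
    G\<lparr>carrier := {x \<in> carrier G. \<exists>n::nat. n > 0 \<and> x [^]\<^bsub>G\<^esub> n = \<one>\<^bsub>G\<^esub>}\<rparr>"

end

theory Submission
  imports Defs
begin

text \<open>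
  Here \<open>D = 5pq \<equiv> 3 (mod 8)\<close>. On \<open>y\<^sup>2 = x\<^sup>3 - D x\<close> the 2-adic order of a nonzero \<open>x(P)\<close> is even and
  nonzero, say \<open>2s\<close>: for a unit \<open>x\<close> the order of \<open>x(x\<^sup>2 - D)\<close> would be 1. Vieta's formulas for
  chords and tangents show that odd multiples of \<open>P\<close> again have order \<open>2s\<close>, whereas even multiples
  are \<open>O\<close> or have order at most \<open>-2(|s| + 1)\<close>. Hence the least \<open>n > 0\<close> with \<open>nP = O\<close> would be an
  even number \<open>2m\<close>. From \<open>(P + Q) - Q = P\<close> alone, without associativity, one gets
  \<open>(n - j)P = -jP\<close>, so \<open>mP = -mP\<close> is a point \<open>(x', 0)\<close> with \<open>x' \<noteq> 0\<close>. This is impossible, because the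
  \<open>y\<close>-coordinate of a point with nonzero \<open>x\<close> has a finite order.
\<close>

section \<open>Chords and cancellation\<close>

fun point_neg :: "'a::field point \<Rightarrow> 'a point" where
  "point_neg Infinity = Infinity"
| "point_neg (Affine x y) = Affine x (- y)"

text \<open>The three intersections, counted with multiplicity, of the line \<open>y = s x + c\<close> with the curve:
  comparing coefficients in \<open>X\<^sup>3 + a X + b - (s X + c)\<^sup>2 = (X - x1) (X - x2) (X - x3)\<close>.\<close>

definition collinear_points ::
    "'a::field \<Rightarrow> 'a \<Rightarrow> 'a \<Rightarrow> 'a \<Rightarrow> 'a \<Rightarrow> 'a \<Rightarrow> 'a \<Rightarrow> 'a \<Rightarrow> 'a \<Rightarrow> 'a \<Rightarrow> bool" where
  "collinear_points a b s c x1 y1 x2 y2 x3 y3 \<longleftrightarrow>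
     y1 = s * x1 + c \<and> y2 = s * x2 + c \<and> y3 = s * x3 + c \<and>
     x1 + x2 + x3 = s^2 \<and> x1 * x2 + x1 * x3 + x2 * x3 = a - 2 * s * c \<and>
     x1 * x2 * x3 = c^2 - b"

text \<open>Puts chords and tangents under the same Vieta relations, so that later arguments need
  not separate them. The sum is the reflection of the third intersection, hence
  \<open>- y3\<close>.\<close>

lemma point_add_collinear:
  fixes a b :: "'a::field_char_0"
  assumes 1: "y1^2 = x1^3 + a * x1 + b" and 2: "y2^2 = x2^3 + a * x2 + b"
    and ne: "\<not> (x1 = x2 \<and> y1 = - y2)"
  obtains s c x3 y3 where "point_add a (Affine x1 y1) (Affine x2 y2) = Affine x3 y3"
    "collinear_points a b s c x1 y1 x2 y2 x3 (- y3)"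
proof -
  define s where "s = (if x1 = x2 then (3 * x1^2 + a) / (2 * y1) else (y2 - y1) / (x2 - x1))"
  define c where "c = y1 - s * x1"
  define x3 where "x3 = s^2 - x1 - x2"
  have "point_add a (Affine x1 y1) (Affine x2 y2) = Affine x3 (s * (x1 - x3) - y1)"
    using ne by (auto simp: s_def x3_def Let_def)
  moreover have "collinear_points a b s c x1 y1 x2 y2 x3 (- (s * (x1 - x3) - y1))"
  proof -
    have e: "x1 * x2 + x1 * x3 + x2 * x3 = a - 2 * s * c \<and> y2 = s * x2 + c"
    proof (cases "x1 = x2")
      case True
      have "y1^2 = y2^2" using 1 2 True by simp
      then have y: "y1 = y2" "y1 \<noteq> 0"
        using ne True by (auto simp: power2_eq_iff)
      have "s * (2 * y1) = 3 * x1^2 + a" using y True by (simp add: s_def)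
      then show ?thesis unfolding c_def x3_def using y True by algebra
    next
      case False
      have s: "s * (x2 - x1) = y2 - y1" using False by (simp add: s_def)
      \<comment> \<open>The difference of the two curve equations, with \<open>x2 - x1\<close>
        factored out of both sides.\<close>
      have "(x2 - x1) * (s * (y1 + y2)) = (x2 - x1) * (x1^2 + x1 * x2 + x2^2 + a)"
        using s 1 2 by algebra
      then have "s * (y1 + y2) = x1^2 + x1 * x2 + x2^2 + a" using False by simp
      then show ?thesis unfolding c_def x3_def using s by algebra
    qed
    have "x1 * x2 * x3 = c^2 - b"
      using e 1 unfolding c_def x3_def by algebra
    then show ?thesis
      using e unfolding collinear_points_def by (simp add: c_def x3_def algebra_simps)
  qed
  ultimately show thesis using that by blast
qed

lemma collinear_on_curve:
  assumes "collinear_points a b s c x1 y1 x2 y2 x3 y3"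
  shows "y3^2 = x3^3 + a * x3 + b"
  using assms unfolding collinear_points_def by algebra

lemma on_curve_point_add:
  fixes a b :: "'a::field_char_0"
  assumes "on_curve a b P" "on_curve a b Q"
  shows "on_curve a b (point_add a P Q)"
proof (cases P; cases Q)
  fix x1 y1 x2 y2 assume *: "P = Affine x1 y1" "Q = Affine x2 y2"
  have 1: "y1^2 = x1^3 + a * x1 + b" and 2: "y2^2 = x2^3 + a * x2 + b"
    using assms * by simp_all
  show ?thesis
  proof (cases "x1 = x2 \<and> y1 = - y2")
    case False
    obtain s c x3 y3 where 3: "point_add a (Affine x1 y1) (Affine x2 y2) = Affine x3 y3"
      "collinear_points a b s c x1 y1 x2 y2 x3 (- y3)"
      by (rule point_add_collinear[OF 1 2 False])
    show ?thesis unfolding * 3(1) using collinear_on_curve[OF 3(2)] by simp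
  qed (use * in auto)
qed (use assms in auto)

text \<open>Converse of \<open>point_add_collinear\<close>. As the Vieta relations are symmetric in
  the three points, one line yields the sum of any two of them.\<close>

lemma point_add_eq_if_collinear:
  fixes a b :: "'a::field_char_0"
  assumes col: "collinear_points a b s c x1 y1 x2 y2 x3 y3"
    and nonsing: "4 * a^3 + 27 * b^2 \<noteq> 0"
  shows "point_add a (Affine x1 y1) (Affine x2 y2) = Affine x3 (- y3)"
proof -
  have x3: "s^2 - x1 - x2 = x3" and y3: "s * (x1 - x3) - y1 = - y3"
    using col by (auto simp: collinear_points_def algebra_simps)
  have add: "point_add a (Affine x1 y1) (Affine x2 y2) = Affine x3 (- y3)"
    if "\<not> (x1 = x2 \<and> y1 = - y2)"
      "(if x1 = x2 then (3 * x1^2 + a) / (2 * y1) else (y2 - y1) / (x2 - x1)) = s"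
    unfolding point_add.simps that(2) Let_def x3 y3 using that(1) by (simp only: if_False)
  show ?thesis
  proof (cases "x1 = x2")
    case True
    then have y: "y1 = y2" using col by (simp add: collinear_points_def)
    have d: "3 * x1^2 + a = s * (2 * y1)"
      using col True unfolding collinear_points_def by algebra
    \<comment> \<open>A line of finite slope meets the curve twice at \<open>(x1, 0)\<close> only if that point is singular.\<close>
    have "y1 \<noteq> 0"
    proof
      assume "y1 = 0"
      then have "3 * x1^2 + a = 0" "x1^3 + a * x1 + b = 0"
        using d col unfolding collinear_points_def by (simp, algebra)
      then have "4 * a^3 + 27 * b^2 = 0" by algebra
      then show False using nonsing by simp
    qed
    then show ?thesis using d True y by (intro add) simp_all
  next
    case False
    then have "(y2 - y1) / (x2 - x1) = s"
      using col by (simp add: collinear_points_def field_simps)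
    then show ?thesis using False by (intro add) simp_all
  qed
qed

text \<open>Reflecting the line through P, Q and -(P + Q) in the x-axis gives a line through P + Q,
  -Q and -P.\<close>

lemma point_add_cancel_right:
  fixes a b :: "'a::field_char_0"
  assumes "on_curve a b P" "on_curve a b Q" and nonsing: "4 * a^3 + 27 * b^2 \<noteq> 0"
  shows "point_add a (point_add a P Q) (point_neg Q) = P"
proof (cases P; cases Q)
  fix x1 y1 x2 y2 assume *: "P = Affine x1 y1" "Q = Affine x2 y2"
  have 1: "y1^2 = x1^3 + a * x1 + b" and 2: "y2^2 = x2^3 + a * x2 + b"
    using assms * by simp_all
  show ?thesis
  proof (cases "x1 = x2 \<and> y1 = - y2")
    case False
    obtain s c x3 y3 where 3: "point_add a (Affine x1 y1) (Affine x2 y2) = Affine x3 y3"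
      "collinear_points a b s c x1 y1 x2 y2 x3 (- y3)"
      by (rule point_add_collinear[OF 1 2 False])
    have "collinear_points a b (- s) (- c) x3 y3 x2 (- y2) x1 (- y1)"
      using 3(2) unfolding collinear_points_def by algebra
    from point_add_eq_if_collinear[OF this nonsing] show ?thesis unfolding * 3(1) by simp
  qed (use * in auto)
qed (use assms in auto)

text \<open>Reflection in the x-axis changes the sign of the slope and fixes its square.\<close>

lemma point_neg_add:
  "point_neg (point_add a P Q) = point_add a (point_neg P) (point_neg Q)"
proof (cases P; cases Q)
  fix x1 y1 x2 y2 assume *: "P = Affine x1 y1" "Q = Affine x2 y2"
  have s: "(if x1 = x2 then (3 * x1^2 + a) / (2 * - y1) else (- y2 - - y1) / (x2 - x1))
     = - (if x1 = x2 then (3 * x1^2 + a) / (2 * y1) else (y2 - y1) / (x2 - x1))"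
    by (simp add: divide_minus_left[symmetric] del: divide_minus_left)
  have m: "x1 = x2 \<and> - y1 = - (- y2) \<longleftrightarrow> x1 = x2 \<and> y1 = - y2"
    by (metis minus_minus)
  show ?thesis
    unfolding * point_neg.simps point_add.simps s m Let_def
    by (simp add: algebra_simps)
qed auto

section \<open>The 2-adic order of a rational number\<close>

text \<open>A relation rather than a function: 0 has no order, so having any order certifies that a
  number is nonzero.\<close>

definition has_dyadic_order :: "rat \<Rightarrow> int \<Rightarrow> bool" where
  "has_dyadic_order x k \<longleftrightarrow>
     (\<exists>u w. odd u \<and> odd w \<and> x = 2 powi k * of_int u / of_int w)"

lemma has_dyadic_order_nonzero: "has_dyadic_order x k \<Longrightarrow> x \<noteq> 0"
  by (auto simp: has_dyadic_order_def)

lemma has_dyadic_order_odd: "odd m \<Longrightarrow> has_dyadic_order (of_int m) 0"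
  unfolding has_dyadic_order_def by (intro exI[of _ m] exI[of _ 1]) auto

lemma has_dyadic_order_int:
  assumes "m \<noteq> 0"
  shows "\<exists>k. has_dyadic_order (of_int m) k"
proof -
  define n where "n = multiplicity 2 m"
  obtain u where m: "m = 2 ^ n * u" and "odd u"
    using multiplicity_decompose'[of m 2] assms by (auto simp: n_def)
  then have "of_int m = 2 powi int n * of_int u / (of_int 1 :: rat)"
    unfolding m by simp
  then have "has_dyadic_order (of_int m) (int n)"
    using \<open>odd u\<close> odd_one unfolding has_dyadic_order_def by blast
  then show ?thesis ..
qed

lemma has_dyadic_order_mult:
  "has_dyadic_order x j \<Longrightarrow> has_dyadic_order y k \<Longrightarrow> has_dyadic_order (x * y) (j + k)"
  unfolding has_dyadic_order_def
  by (elim exE conjE, rule_tac x="u * ua" in exI, rule_tac x="w * wa" in exI)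
     (simp add: power_int_add)

lemma has_dyadic_order_divide:
  "has_dyadic_order x j \<Longrightarrow> has_dyadic_order y k \<Longrightarrow> has_dyadic_order (x / y) (j - k)"
  unfolding has_dyadic_order_def
  by (elim exE conjE, rule_tac x="u * wa" in exI, rule_tac x="w * ua" in exI)
     (simp add: power_int_diff mult_ac)

lemma has_dyadic_order_power:
  "has_dyadic_order x j \<Longrightarrow> has_dyadic_order (x ^ n) (int n * j)"
proof (induction n)
  case 0
  then show ?case using has_dyadic_order_odd[of 1] by simp
next
  case (Suc n)
  then show ?case using has_dyadic_order_mult[of x j "x ^ n" "int n * j"]
    by (simp add: algebra_simps)
qed

lemma has_dyadic_order_exists:
  assumes "x \<noteq> 0"
  obtains k where "has_dyadic_order x k"
proof -
  obtain m n where "x = of_int m / of_int n" "n > 0"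
    using quotient_of_div[of x] quotient_of_denom_pos'[of x] by (metis surj_pair snd_conv)
  moreover from this obtain j k where "has_dyadic_order (of_int m) j" "has_dyadic_order (of_int n) k"
    using has_dyadic_order_int assms by (metis div_0 less_irrefl of_int_0)
  ultimately show thesis using has_dyadic_order_divide that by blast
qed

lemma has_dyadic_order_minus: "has_dyadic_order x k \<Longrightarrow> has_dyadic_order (- x) k"
  using has_dyadic_order_mult[OF has_dyadic_order_odd[of "- 1"]] by simp

lemma has_dyadic_order_add_less:
  assumes "has_dyadic_order x j" "has_dyadic_order y k" "j < k"
  shows "has_dyadic_order (x + y) j"
proof -
  obtain u w u' w' where o: "odd u" "odd w" "odd u'" "odd w'"
    and x: "x = 2 powi j * of_int u / of_int w" and y: "y = 2 powi k * of_int u' / of_int w'"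
    using assms by (auto simp: has_dyadic_order_def)
  define n where "n = nat (k - j)"
  have k: "(2::rat) powi k = 2 powi j * 2 ^ n" and n: "n > 0"
    using assms(3) power_int_add[of "2::rat" j "int n"] by (auto simp: n_def power_int_def)
  have w: "of_int w \<noteq> (0::rat)" "of_int w' \<noteq> (0::rat)" using o by auto
  \<comment> \<open>With \<open>2 powi j\<close> factored out, the numerator is an odd number plus
    an even one.\<close>
  have "odd (u * w' + 2 ^ n * u' * w)" "odd (w * w')" using o n by auto
  moreover have "x + y = 2 powi j * of_int (u * w' + 2 ^ n * u' * w) / of_int (w * w')"
    using w by (simp add: x y k field_simps)
  ultimately show ?thesis unfolding has_dyadic_order_def by blast
qed

text \<open>If j < k were both orders of x, then x - x = 0 would have order j.\<close>

lemma has_dyadic_order_unique: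
  assumes "has_dyadic_order x j" "has_dyadic_order x k"
  shows "j = k"
proof -
  have False if "has_dyadic_order x j" "has_dyadic_order x k" "j < k" for j k
    using has_dyadic_order_add_less[OF that(1) has_dyadic_order_minus[OF that(2)] that(3)]
      has_dyadic_order_nonzero by auto
  then show ?thesis using assms by (meson linorder_neqE)
qed

text \<open>The two odd numerators add up to an even one, which contributes at least one more factor
  2.\<close>

lemma has_dyadic_order_add_eq:
  assumes "has_dyadic_order x k" "has_dyadic_order y k" "x + y \<noteq> 0"
  obtains m where "m > k" "has_dyadic_order (x + y) m"
proof -
  obtain u w u' w' where o: "odd u" "odd w" "odd u'" "odd w'"
    and x: "x = 2 powi k * of_int u / of_int w" and y: "y = 2 powi k * of_int u' / of_int w'"
    using assms by (auto simp: has_dyadic_order_def)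
  have "even (u * w' + u' * w)" using o by auto
  then obtain t where t: "u * w' + u' * w = 2 * t" by blast
  have w: "of_int w \<noteq> (0::rat)" "of_int w' \<noteq> (0::rat)" using o by auto
  have "x + y = 2 powi k * of_int (u * w' + u' * w) / of_int (w * w')"
    using w by (simp add: x y field_simps)
  then have s: "x + y = 2 powi (k + 1) * of_int t / of_int (w * w')"
    unfolding t by (simp add: power_int_add_1)
  then have "t \<noteq> 0" using assms(3) by auto
  define n where "n = multiplicity 2 t"
  obtain v where t: "t = 2 ^ n * v" and "odd v"
    using multiplicity_decompose'[of t 2] \<open>t \<noteq> 0\<close> by (auto simp: n_def)
  have "x + y = 2 powi (k + 1 + int n) * of_int v / of_int (w * w')"
    unfolding s t by (subst power_int_add) auto
  moreover have "odd (w * w')" using o by simp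
  ultimately have "has_dyadic_order (x + y) (k + 1 + int n)"
    using \<open>odd v\<close> unfolding has_dyadic_order_def by blast
  then show thesis by (intro that) auto
qed

lemma has_dyadic_order_sqrt:
  assumes "has_dyadic_order (x^2) m"
  obtains k where "m = 2 * k" "has_dyadic_order x k"
proof -
  have "x \<noteq> 0" using has_dyadic_order_nonzero[OF assms] by auto
  then obtain k where k: "has_dyadic_order x k" by (rule has_dyadic_order_exists)
  have "has_dyadic_order (x^2) (2 * k)" using has_dyadic_order_power[OF k, of 2] by simp
  then have "m = 2 * k" using has_dyadic_order_unique assms by blast
  with k show thesis using that by blast
qed

section \<open>Points on \<open>y\<^sup>2 = x\<^sup>3 - D x\<close> with \<open>D \<equiv> 3 (mod 8)\<close>\<close>

lemma odd_square_mod_8: "odd (u::int) \<Longrightarrow> u^2 mod 8 = 1"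
proof -
  assume "odd u"
  then have "u mod 8 \<in> {1,3,5,7}" by (simp; presburger)
  then have "(u mod 8)^2 mod 8 = 1" by auto
  then show ?thesis by (simp add: power_mod)
qed

text \<open>The terms x^3 and D x have orders 3k and k. For k > 0 the second dominates, for k < 0
  the first, and the order of y^2 must be even. In particular y has an order, so it is
  nonzero.\<close>

lemma curve_dyadic_order:
  fixes D :: int
  assumes D: "D mod 8 = 3" and curve: "y^2 = x^3 - of_int D * x" and x: "x \<noteq> 0"
  obtains s where "s \<noteq> 0" "has_dyadic_order x (2 * s)" "has_dyadic_order y (min s (3 * s))"
proof -
  have "odd D" using D by presburger
  note oD = has_dyadic_order_odd[OF this]
  obtain k where k: "has_dyadic_order x k" using x by (rule has_dyadic_order_exists)
  have o3: "has_dyadic_order (x^3) (3 * k)" using has_dyadic_order_power[OF k, of 3] by simp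
  have o1: "has_dyadic_order (- (of_int D * x)) k"
    using has_dyadic_order_minus[OF has_dyadic_order_mult[OF oD k]] by simp
  have y: "y^2 = x^3 + - (of_int D * x)" using curve by simp
  consider "k = 0" | "k > 0" | "k < 0" by linarith
  then show thesis
  proof cases
    case 1
    then obtain u w where o: "odd u" "odd w" and xu: "x = of_int u / of_int w"
      using k by (auto simp: has_dyadic_order_def)
    \<comment> \<open>Odd squares are 1 mod 8, so u^2 - D w^2 is 1 - 3 = 6 mod 8, twice an odd
      number. Then y^2 would have the odd order 1.\<close>
    have "D * w^2 mod 8 = 3" using mod_mult_eq[of D 8 "w^2"] o by (simp add: odd_square_mod_8 D)
    then have "(u^2 - D * w^2) mod 8 = 6"
      using mod_diff_eq[of "u^2" 8 "D * w^2"] o by (simp add: odd_square_mod_8)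
    then have "u^2 - D * w^2 = 2 * ((u^2 - D * w^2) div 2)" "odd ((u^2 - D * w^2) div 2)"
      by presburger+
    then obtain t where t: "u^2 - D * w^2 = 2 * t" "odd t" by blast
    have w: "of_int w \<noteq> (0::rat)" using o by auto
    have "y^2 = of_int u * of_int (u^2 - D * w^2) / of_int (w^3)"
      unfolding curve xu using w by (simp add: field_simps power2_eq_square power3_eq_cube)
    then have "y^2 = 2 powi 1 * of_int (u * t) / of_int (w^3)"
      unfolding t(1) by simp
    moreover have "odd (u * t)" "odd (w^3)" using o t by auto
    ultimately have "has_dyadic_order (y^2) 1" unfolding has_dyadic_order_def by blast
    then show thesis by (rule has_dyadic_order_sqrt) presburger
  next
    case 2
    then have "has_dyadic_order (y^2) k"
      unfolding y using has_dyadic_order_add_less[OF o1 o3] by (simp add: add.commute)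
    then obtain s where "k = 2 * s" "has_dyadic_order y s" by (rule has_dyadic_order_sqrt)
    then show thesis using 2 k by (intro that[of s]) auto
  next
    case 3
    then have "has_dyadic_order (y^2) (3 * k)"
      unfolding y using has_dyadic_order_add_less[OF o3 o1] by simp
    then obtain j where j: "3 * k = 2 * j" "has_dyadic_order y j" by (rule has_dyadic_order_sqrt)
    define s where "s = k div 2"
    have "k = 2 * s" "j = 3 * s" using j(1) by (auto simp: s_def; presburger)+
    then show thesis using 3 k j by (intro that[of s]) auto
  qed
qed

text \<open>Adding two points of equal order gives a steep line: \<open>y1 + y2\<close> gains a
  factor 2 while its product with the slope has a known order. The square of the slope then
  dominates in \<open>x3 = l^2 - x1 - x2\<close>.\<close>

lemma collinear_order_eq:
  fixes D :: int
  assumes col: "collinear_points (- of_int D) 0 l c x1 y1 x2 y2 x3 y3" and "odd D" "s \<noteq> 0"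
    and x1: "has_dyadic_order x1 (2 * s)" and x2: "has_dyadic_order x2 (2 * s)"
    and y1: "has_dyadic_order y1 (min s (3 * s))" and y2: "has_dyadic_order y2 (min s (3 * s))"
  obtains t where "t \<le> - 2 * (\<bar>s\<bar> + 1)" "has_dyadic_order x3 t"
proof -
  have oD: "has_dyadic_order (- of_int D) 0"
    using has_dyadic_order_minus[OF has_dyadic_order_odd] \<open>odd D\<close> by blast
  \<comment> \<open>This form of the slope equation holds for chords and tangents alike.\<close>
  have slope: "l * (y1 + y2) = x1^2 + x2 * (x1 + x2) + - of_int D"
    using col unfolding collinear_points_def by algebra
  have sq: "has_dyadic_order (x1^2) (4 * s)" using has_dyadic_order_power[OF x1, of 2] by simp
  have q: "has_dyadic_order (x1^2 + x2 * (x1 + x2)) (4 * s)"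
  proof (cases "x1 + x2 = 0")
    case True
    then show ?thesis using sq by simp
  next
    case False
    obtain m where m: "m > 2 * s" "has_dyadic_order (x1 + x2) m"
      using has_dyadic_order_add_eq[OF x1 x2 False] .
    show ?thesis
      using has_dyadic_order_add_less[OF sq has_dyadic_order_mult[OF x2 m(2)]] m(1) by simp
  qed
  have r: "has_dyadic_order (l * (y1 + y2)) (min (4 * s) 0)"
  proof (cases "s < 0")
    case True
    then show ?thesis unfolding slope using has_dyadic_order_add_less[OF q oD] by simp
  next
    case False
    then show ?thesis unfolding slope using \<open>s \<noteq> 0\<close> has_dyadic_order_add_less[OF oD q]
      by (simp add: add.commute)
  qed
  then have "y1 + y2 \<noteq> 0" using has_dyadic_order_nonzero by fastforce
  obtain m where m: "m > min s (3 * s)" "has_dyadic_order (y1 + y2) m"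
    using has_dyadic_order_add_eq[OF y1 y2 \<open>y1 + y2 \<noteq> 0\<close>] .
  define n where "n = min (4 * s) 0 - m"
  have l: "has_dyadic_order l n"
    using has_dyadic_order_divide[OF r m(2)] \<open>y1 + y2 \<noteq> 0\<close> by (simp add: n_def)
  \<comment> \<open>For either sign of s, min(4s, 0) - min(s, 3s) = -|s|; the strict bound on
    \<open>m\<close> gives the extra 1.\<close>
  have n: "n \<le> - (\<bar>s\<bar> + 1)" using m(1) by (auto simp: n_def min_def abs_if split: if_splits)
  have l2: "has_dyadic_order (l^2) (2 * n)" using has_dyadic_order_power[OF l, of 2] by simp
  have lt: "2 * n < 2 * s" using n by linarith
  have "has_dyadic_order (l^2 + - x1 + - x2) (2 * n)"
    using has_dyadic_order_add_less lt l2 has_dyadic_order_minus x1 x2 by blast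
  moreover have "l^2 + - x1 + - x2 = x3"
    using col unfolding collinear_points_def by (simp add: algebra_simps)
  ultimately show thesis using n by (intro that[of "2 * n"]) auto
qed

text \<open>In the sum formula \<open>l^2\<close> and \<open>x1\<close> have the same order 2t and
  may cancel. The product formula \<open>x1 * x2 * x3 = c^2\<close> avoids this: the intercept
  \<open>c\<close> has order t + 2s.\<close>

lemma collinear_order_less:
  fixes D :: int
  assumes col: "collinear_points (- of_int D) 0 l c x1 y1 x2 y2 x3 y3"
    and less: "t < - \<bar>s\<bar>"
    and x1: "has_dyadic_order x1 (2 * t)" and x2: "has_dyadic_order x2 (2 * s)"
    and y1: "has_dyadic_order y1 (3 * t)" and y2: "has_dyadic_order y2 (min s (3 * s))"
  shows "has_dyadic_order x3 (2 * s)"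
proof -
  have t: "2 * t < 2 * s" "3 * t < min s (3 * s)" "t + 2 * s < min s (3 * s)" using less by auto
  have dx: "has_dyadic_order (x1 - x2) (2 * t)"
    using has_dyadic_order_add_less[OF x1 has_dyadic_order_minus[OF x2] t(1)] by simp
  have dy: "has_dyadic_order (y1 - y2) (3 * t)"
    using has_dyadic_order_add_less[OF y1 has_dyadic_order_minus[OF y2] t(2)] by simp
  have "l = (y1 - y2) / (x1 - x2)"
    using col has_dyadic_order_nonzero[OF dx]
    by (simp add: collinear_points_def field_simps)
  then have l: "has_dyadic_order l t" using has_dyadic_order_divide[OF dy dx] by simp
  have "has_dyadic_order (- (l * x2) + y2) (t + 2 * s)"
    using has_dyadic_order_add_less[OF has_dyadic_order_minus[OF has_dyadic_order_mult[OF l x2]] y2 t(3)] .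
  moreover have "- (l * x2) + y2 = c" using col by (simp add: collinear_points_def)
  ultimately have "has_dyadic_order (c^2) (2 * (t + 2 * s))"
    using has_dyadic_order_power[of c "t + 2 * s" 2] by simp
  then have "has_dyadic_order (c^2 / (x1 * x2)) (2 * (t + 2 * s) - (2 * t + 2 * s))"
    by (rule has_dyadic_order_divide[OF _ has_dyadic_order_mult[OF x1 x2]])
  moreover have "c^2 / (x1 * x2) = x3"
    using col x1 x2 by (simp add: collinear_points_def has_dyadic_order_nonzero field_simps)
  ultimately show ?thesis by simp
qed

section \<open>Multiples of a point\<close>

fun point_multiple :: "'a::field \<Rightarrow> nat \<Rightarrow> 'a point \<Rightarrow> 'a point" where
  "point_multiple a 0 P = Infinity"
| "point_multiple a (Suc n) P = point_add a (point_multiple a n P) P"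

lemma elliptic_curve_group_pow:
  "P [^]\<^bsub>elliptic_curve_group a b\<^esub> n = point_multiple a n P"
  by (induction n) (simp_all add: nat_pow_def elliptic_curve_group_def)

lemma on_curve_point_multiple:
  fixes a b :: "'a::field_char_0"
  shows "on_curve a b P \<Longrightarrow> on_curve a b (point_multiple a n P)"
  by (induction n) (auto intro: on_curve_point_add)

text \<open>Descends from nP = O, removing one P at a time with
  \<open>point_add_cancel_right\<close> and collecting the removed copies with
  \<open>point_neg_add\<close>.\<close>

lemma point_multiple_neg:
  fixes a b :: "'a::field_char_0"
  assumes P: "on_curve a b P" and nonsing: "4 * a^3 + 27 * b^2 \<noteq> 0"
    and inf: "point_multiple a n P = Infinity" and "j \<le> n"
  shows "point_multiple a (n - j) P = point_neg (point_multiple a j P)"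
  using \<open>j \<le> n\<close>
proof (induction j)
  case 0
  then show ?case using inf by simp
next
  case (Suc j)
  then have "point_multiple a (n - j) P = point_add a (point_multiple a (n - Suc j) P) P"
    by (metis Suc_diff_Suc Suc_le_lessD point_multiple.simps(2))
  then have "point_multiple a (n - Suc j) P = point_add a (point_multiple a (n - j) P) (point_neg P)"
    using point_add_cancel_right[OF on_curve_point_multiple[OF P] P nonsing] by simp
  then show ?case using Suc by (simp add: point_neg_add)
qed

text \<open>Induction with alternating parity: adding P to an even multiple is
  \<open>collinear_order_less\<close>, to an odd one \<open>collinear_order_eq\<close>. The bound on
  \<open>t\<close> is what the former requires.\<close>

lemma point_multiple_order:
  fixes D :: int
  assumes D: "D mod 8 = 3" and curve: "on_curve (- of_int D) 0 (Affine x y)"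
    and s: "s \<noteq> 0" "has_dyadic_order x (2 * s)" "has_dyadic_order y (min s (3 * s))"
  shows "(even n \<longrightarrow> point_multiple (- of_int D) n (Affine x y) = Infinity \<or>
            (\<exists>x' y' t. point_multiple (- of_int D) n (Affine x y) = Affine x' y' \<and>
               has_dyadic_order x' t \<and> t \<le> - 2 * (\<bar>s\<bar> + 1))) \<and>
         (odd n \<longrightarrow> (\<exists>x' y'. point_multiple (- of_int D) n (Affine x y) = Affine x' y' \<and>
               has_dyadic_order x' (2 * s)))"
    (is "(even n \<longrightarrow> ?E n) \<and> (odd n \<longrightarrow> ?O n)")
proof (induction n)
  case 0
  then show ?case by simp
next
  case (Suc n)
  define a :: rat where "a = - of_int D"
  define Q where "Q = point_multiple a n (Affine x y)"
  have onQ: "on_curve a 0 Q"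
    unfolding Q_def using on_curve_point_multiple curve a_def by blast
  have xy: "y^2 = x^3 + a * x + 0" using curve by (simp add: a_def)
  have "odd D" using D by presburger
  show ?case
  proof (cases "even n")
    case True
    have "?O (Suc n)"
    proof (cases Q)
      case Infinity
      then show ?thesis using s by (simp add: Q_def a_def)
    next
      case (Affine x' y')
      then obtain t where t: "has_dyadic_order x' t" "t \<le> - 2 * (\<bar>s\<bar> + 1)"
        using Suc True by (auto simp: Q_def a_def)
      have xy': "y'^2 = x'^3 + a * x' + 0" using onQ Affine by simp
      obtain r where r: "r \<noteq> 0" "has_dyadic_order x' (2 * r)" "has_dyadic_order y' (min r (3 * r))"
        using curve_dyadic_order[OF D, of y' x'] xy' has_dyadic_order_nonzero[OF t(1)]
        by (auto simp: a_def)
      have "t = 2 * r" using has_dyadic_order_unique t r by blast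
      then have less: "r < - \<bar>s\<bar>" using t(2) by simp
      then have r3: "has_dyadic_order y' (3 * r)" using r(3) by (simp add: min_def split: if_splits)
      \<comment> \<open>The orders 2r < 2s of the x-coordinates differ, so the line is not
        vertical.\<close>
      have "\<not> (x' = x \<and> y' = - y)" using has_dyadic_order_unique[OF r(2)] s(2) less by fastforce
      obtain l c x3 y3 where 3: "point_add a (Affine x' y') (Affine x y) = Affine x3 y3"
        "collinear_points a 0 l c x' y' x y x3 (- y3)"
        by (rule point_add_collinear[OF xy' xy \<open>\<not> (x' = x \<and> y' = - y)\<close>])
      have "has_dyadic_order x3 (2 * s)"
        using collinear_order_less[OF 3(2)[unfolded a_def] less r(2) s(2) r3 s(3)] .
      then show ?thesis using 3 Affine by (simp add: Q_def a_def)
    qed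
    then show ?thesis using True by simp
  next
    case False
    then obtain x' y' where Q: "Q = Affine x' y'" and x': "has_dyadic_order x' (2 * s)"
      using Suc by (auto simp: Q_def a_def)
    have xy': "y'^2 = x'^3 + a * x' + 0" using onQ Q by simp
    obtain r where r: "r \<noteq> 0" "has_dyadic_order x' (2 * r)" "has_dyadic_order y' (min r (3 * r))"
      using curve_dyadic_order[OF D, of y' x'] xy' has_dyadic_order_nonzero[OF x']
      by (auto simp: a_def)
    \<comment> \<open>Hence \<open>y'\<close> has the same order as \<open>y\<close>.\<close>
    have "r = s" using has_dyadic_order_unique[OF r(2) x'] by simp
    have "?E (Suc n)"
    proof (cases "x' = x \<and> y' = - y")
      case True
      then show ?thesis using Q by (simp add: Q_def a_def)
    next
      case False
      obtain l c x3 y3 where 3: "point_add a (Affine x' y') (Affine x y) = Affine x3 y3"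
        "collinear_points a 0 l c x' y' x y x3 (- y3)"
        by (rule point_add_collinear[OF xy' xy False])
      obtain t where "t \<le> - 2 * (\<bar>s\<bar> + 1)" "has_dyadic_order x3 t"
        using collinear_order_eq[OF 3(2)[unfolded a_def] \<open>odd D\<close> s(1) x' s(2) _ s(3)] r
        \<open>r = s\<close> by blast
      then show ?thesis using 3 Q by (auto simp: Q_def a_def)
    qed
    then show ?thesis using False by simp
  qed
qed

lemma point_multiple_nonzero:
  fixes D :: int and x y :: rat
  assumes D: "D mod 8 = 3" and curve: "on_curve (- of_int D) 0 (Affine x y)"
    and "x \<noteq> 0" "n > 0"
  shows "point_multiple (- of_int D) n (Affine x y) \<noteq> Infinity"
proof
  define M where "M k = point_multiple (- of_int D) k (Affine x y)" for k
  assume "point_multiple (- of_int D) n (Affine x y) = Infinity"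
  then have ex: "\<exists>k. k > 0 \<and> M k = Infinity"
    using \<open>n > 0\<close> by (intro exI[of _ n]) (simp add: M_def)
  define k where "k = (LEAST k. k > 0 \<and> M k = Infinity)"
  have k: "k > 0" "M k = Infinity"
    using LeastI_ex[OF ex] unfolding k_def by blast+
  have least: "k \<le> j" if "j > 0" "M j = Infinity" for j
    unfolding k_def by (rule Least_le) (use that in blast)
  have "y^2 = x^3 - of_int D * x" using curve by simp
  then obtain s where s: "s \<noteq> 0" "has_dyadic_order x (2 * s)"
      "has_dyadic_order y (min s (3 * s))"
    using \<open>x \<noteq> 0\<close> by (rule curve_dyadic_order[OF D])
  note ord = point_multiple_order[OF D curve s, folded M_def]
  \<comment> \<open>Odd multiples are affine.\<close>
  have "even k" using ord[of k] k(2) by (metis point.distinct(1))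
  then obtain m where m: "k = 2 * m" by blast
  have "D \<noteq> 0" using D by auto
  then have nonsing: "4 * (- of_int D)^3 + 27 * 0^2 \<noteq> (0::rat)" by simp
  have "k - m = m" "m \<le> k" using m by simp_all
  then have neg: "point_neg (M m) = M m"
    using point_multiple_neg[OF curve nonsing k(2)[unfolded M_def], folded M_def, of m] by metis
  have "M m \<noteq> Infinity" using least[of m] m k(1) by auto
  \<comment> \<open>By minimality of k the half multiple is affine, and being its own negative it
    has y = -y = 0.\<close>
  then obtain x' where x': "M m = Affine x' 0" using neg by (cases "M m") auto
  have "\<exists>t. has_dyadic_order x' t"
    using ord[of m] unfolding x' by (cases "even m") auto
  then have "x' \<noteq> 0" using has_dyadic_order_nonzero by blast
  \<comment> \<open>The contradiction: \<open>curve_dyadic_order\<close> now assigns an order to the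
    y-coordinate 0.\<close>
  have "on_curve (- of_int D) 0 (Affine x' 0)"
    using on_curve_point_multiple[OF curve, of m] x' by (simp add: M_def)
  then have "0^2 = x'^3 - of_int D * x'" by simp
  then obtain r where "has_dyadic_order 0 (min r (3 * r))"
    using \<open>x' \<noteq> 0\<close> by (rule curve_dyadic_order[OF D])
  then show False using has_dyadic_order_nonzero by blast
qed

section \<open>The torsion points and the isomorphism with Z/2\<close>

lemma carrier_torsion_subgroup:
  fixes D :: int
  assumes D: "D mod 8 = 3"
  shows "carrier (torsion_subgroup (elliptic_curve_group (- of_int D :: rat) 0))
           = {Infinity, Affine 0 0}"
proof (intro subset_antisym subsetI)
  let ?G = "elliptic_curve_group (- of_int D :: rat) 0"
  fix P assume "P \<in> carrier (torsion_subgroup ?G)"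
  then obtain n where P: "on_curve (- of_int D) 0 P" "n > 0"
      "point_multiple (- of_int D) n P = Infinity"
    by (auto simp: torsion_subgroup_def elliptic_curve_group_pow)
       (auto simp: elliptic_curve_group_def)
  show "P \<in> {Infinity, Affine 0 0}"
  proof (cases P)
    case (Affine x y)
    then have "x = 0" using point_multiple_nonzero[OF D] P by blast
    then show ?thesis using P Affine by simp
  qed simp
next
  let ?G = "elliptic_curve_group (- of_int D :: rat) 0"
  fix P :: "rat point" assume "P \<in> {Infinity, Affine 0 0}"
  \<comment> \<open>The point (0, 0) is its own negative, so doubling it falls under the
    vertical-line branch.\<close>
  moreover from this have "point_multiple (- of_int D) 2 P = Infinity"
    by (auto simp: numeral_2_eq_2)
  ultimately show "P \<in> carrier (torsion_subgroup ?G)"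
    unfolding torsion_subgroup_def
    by (auto simp: elliptic_curve_group_pow intro!: exI[of _ 2])
       (auto simp: elliptic_curve_group_def)
qed

theorem theorem1p3:
  fixes p q :: nat
  assumes "prime p" and "prime q" and "p \<noteq> q"
    and "[p = 33] (mod 40)" and "[q = 7] (mod 40)"
  shows "torsion_subgroup (elliptic_curve_group (- 5 * of_nat p * of_nat q :: rat) 0)
           \<cong> integer_mod_group 2"
proof -
  define D where "D = 5 * int p * int q"
  let ?G = "torsion_subgroup (elliptic_curve_group (- of_int D :: rat) 0)"
  \<comment> \<open>Since 8 divides 40, both congruences descend, and 5 * 33 * 7 = 1155 is 3 mod
    8.\<close>
  have "[p = 33] (mod 8)" "[q = 7] (mod 8)"
    using assms(4,5) by (auto intro: cong_dvd_modulus_nat)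
  then have "[int p = 33] (mod 8)" "[int q = 7] (mod 8)"
    by (simp_all flip: cong_int_iff)
  then have "[D = 5 * 33 * 7] (mod 8)"
    unfolding D_def by (intro cong_mult cong_refl)
  then have D: "D mod 8 = 3" by (simp add: cong_def)
  note car = carrier_torsion_subgroup[OF D]
  have mul: "x \<otimes>\<^bsub>?G\<^esub> y = point_add (- of_int D) x y" for x y
    by (simp add: torsion_subgroup_def elliptic_curve_group_def)
  \<comment> \<open>On the two torsion points this sends O to 0 and (0, 0) to 1; doubling (0, 0)
    matches 1 + 1 = 0 mod 2.\<close>
  define h :: "rat point \<Rightarrow> int" where "h P = (if P = Infinity then 0 else 1)" for P
  have "h \<in> iso ?G (integer_mod_group 2)"
  proof (rule isoI)
    show "h \<in> hom ?G (integer_mod_group 2)"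
      by (rule homI) (auto simp: car mul h_def carrier_integer_mod_group mult_integer_mod_group)
    have "{0..<2} = {0, 1::int}" by auto
    then show "bij_betw h (carrier ?G) (carrier (integer_mod_group 2))"
      by (auto simp: bij_betw_def inj_on_def car h_def carrier_integer_mod_group)
  qed
  then have "?G \<cong> integer_mod_group 2" by (auto simp: is_iso_def)
  then show ?thesis by (simp add: D_def)
qed

end
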